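(* Let $(X,\triangleright)$ be a Płonka sum of racks $(X_\alpha,\triangleright_\alpha)$ indexed by a (lower) semilattice $Y$. Then $(X,\triangleright)$ is a quasi rack such that $$L^0_a(a)=a\qquad\text{and}\qquad L^0_{L_a(b)}=L^0_aL^0_b$$ for all $a,b\in X$. Moreover, the derived map $r_\triangleright:X\times X\to X\times X$, $r_\triangleright(x,y)=\left(L^0_x(y),\,L_y(x)\right)$, associated to $(X,\triangleright)$ is a quasi bijective and quasi non-degenerate solution.
   Context: Juxtaposition of maps denotes composition, $(fg)(x)=f(g(x))$. For a map $f:Z\to Z$ on a set $Z$, a relative inverse of $f$ is a map $f^-:Z\to Z$ with $ff^-f=f$, $f^-ff^-=f^-$, $ff^-=f^-f$; it is unique if it exists, and $f^0:=ff^-=f^-f$. A (left) shelf $(X,\triangleright)$ is a set with a binary operation such that $x\triangleright(y\triangleright z)=(x\triangleright y)\triangleright(x\triangleright z)$ for all $x,y,z$; write $L_x(y)=x\triangleright y$. A rack is a shelf with all $L_x$ bijective. A quasi rack is a shelf such that every $L_x$ has a relative inverse $L_x^-$ and $L_x^0L_y=L_yL_x^0$ for all $x,y\in X$. Płonka sum of racks: let $Y$ be a (lower) semilattice (meet written as product $\alpha\beta$, with $\alpha\ge\beta$ iff $\alpha\beta=\beta$) and $\{(X_\alpha,\triangleright_\alpha)\mid\alpha\in Y\}$ a family of disjoint racks. For all $\alpha\ge\beta$ in $Y$ let $\phi_{\alpha,\beta}:X_\alpha\to X_\beta$ be a rack homomorphism such that $\phi_{\alpha,\alpha}=\mathrm{id}_{X_\alpha}$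 for all $\alpha$ and $\phi_{\beta,\gamma}\phi_{\alpha,\beta}=\phi_{\alpha,\gamma}$ whenever $\alpha\ge\beta\ge\gamma$. On $X=\bigcup_{\alpha\in Y}X_\alpha$ set $a\triangleright b:=\phi_{\alpha,\alpha\beta}(a)\triangleright_{\alpha\beta}\phi_{\beta,\alpha\beta}(b)$ for $a\in X_\alpha$, $b\in X_\beta$. The resulting shelf $(X,\triangleright)$ is the Płonka sum of the racks $(X_\alpha,\triangleright_\alpha)$ indexed by $Y$. A solution is a pair $(X,r)$ with $r:X\times X\to X\times X$ satisfying $(r\times\mathrm{id}_X)(\mathrm{id}_X\times r)(r\times\mathrm{id}_X)=(\mathrm{id}_X\times r)(r\times\mathrm{id}_X)(\mathrm{id}_X\times r)$; write $r(x,y)=(\lambda_x(y),\rho_y(x))$. It is quasi bijective if there exists a (necessarily unique) solution $(X,r^-)$ with $rr^-r=r$, $r^-rr^-=r^-$ and $r^-r=rr^-$. It is quasi left non-degenerate if every $\lambda_x$ has a relative inverse and $\lambda_x^0\lambda_y=\lambda_y\lambda_x^0$ for all $x,y$; quasi right non-degenerate if every $\rho_x$ has a relative inverse and $\rho_x^0\rho_y=\rho_y\rho_x^0$ for all $x,y$; quasi non-degenerate if both. *)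

theory Defs
  imports Main "HOL-Library.FuncSet" "HOL-Library.Disjoint_Sets"
begin

(* A map Z -> Z on a set Z is a function of type 'a => 'a sending Z to Z; equalities between
   such maps are pointwise equalities on Z, and nothing is assumed about values outside Z. *)

definition relative_inverse :: "'a set \<Rightarrow> ('a \<Rightarrow> 'a) \<Rightarrow> ('a \<Rightarrow> 'a) \<Rightarrow> bool" where
  "relative_inverse Z f g \<longleftrightarrow> f \<in> Z \<rightarrow> Z \<and> g \<in> Z \<rightarrow> Z \<and>
     (\<forall>x\<in>Z. f (g (f x)) = f x) \<and> (\<forall>x\<in>Z. g (f (g x)) = g x) \<and> (\<forall>x\<in>Z. f (g x) = g (f x))"

lemma relative_inverse_unique:
  assumes "relative_inverse Z f g" "relative_inverse Z f h" "x \<in> Z"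
  shows "g x = h x"
proof -
  have Z: "f y \<in> Z" "g y \<in> Z" "h y \<in> Z" if "y \<in> Z" for y
    using assms that by (auto simp: relative_inverse_def)
  have fgf: "f (g (f y)) = f y" and fhf: "f (h (f y)) = f y"
    and gfg: "g (f (g y)) = g y" and hfh: "h (f (h y)) = h y"
    and fg: "f (g y) = g (f y)" and fh: "f (h y) = h (f y)" if "y \<in> Z" for y
    using assms that unfolding relative_inverse_def by blast+
  have e: "f (g y) = f (h y)" if "y \<in> Z" for y
    by (metis Z fgf fhf fg fh that)
  show ?thesis
    by (metis Z e gfg hfh fg fh assms(3))
qed

(* The relative inverse is determined on Z only; extensionality makes the description unique. *)
definition rel_inv :: "'a set \<Rightarrow> ('a \<Rightarrow> 'a) \<Rightarrow> 'a \<Rightarrow> 'a" where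
  "rel_inv Z f = (THE g. g \<in> extensional Z \<and> relative_inverse Z f g)"

lemma rel_inv:
  assumes "\<exists>g. relative_inverse Z f g"
  shows "relative_inverse Z f (rel_inv Z f)"
proof -
  obtain g where g: "relative_inverse Z f g" using assms by blast
  have r: "relative_inverse Z f (restrict g Z)"
    using g by (auto simp: relative_inverse_def Pi_iff)
  have "\<exists>!g. g \<in> extensional Z \<and> relative_inverse Z f g"
  proof (rule ex1I)
    show "restrict g Z \<in> extensional Z \<and> relative_inverse Z f (restrict g Z)" using r by simp
  next
    fix h assume "h \<in> extensional Z \<and> relative_inverse Z f h"
    then show "h = restrict g Z"
      using relative_inverse_unique r by (metis extensionalityI restrict_extensional)
  qed
  from theI'[OF this] show ?thesis by (simp add: rel_inv_def)
qed

definition rel_idem :: "'a set \<Rightarrow> ('a \<Rightarrow> 'a) \<Rightarrow> 'a \<Rightarrow> 'a" where  (* f^0 *)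
  "rel_idem Z f = f \<circ> rel_inv Z f"

(* The left translation L_x of (X, t) is the partial application t x. *)

definition shelf :: "'a set \<Rightarrow> ('a \<Rightarrow> 'a \<Rightarrow> 'a) \<Rightarrow> bool" where
  "shelf X t \<longleftrightarrow> (\<forall>x\<in>X. \<forall>y\<in>X. t x y \<in> X) \<and>
     (\<forall>x\<in>X. \<forall>y\<in>X. \<forall>z\<in>X. t x (t y z) = t (t x y) (t x z))"

definition rack :: "'a set \<Rightarrow> ('a \<Rightarrow> 'a \<Rightarrow> 'a) \<Rightarrow> bool" where
  "rack X t \<longleftrightarrow> shelf X t \<and> (\<forall>x\<in>X. bij_betw (t x) X X)"

definition rack_hom :: "'a set \<Rightarrow> ('a \<Rightarrow> 'a \<Rightarrow> 'a) \<Rightarrow> 'b set \<Rightarrow> ('b \<Rightarrow> 'b \<Rightarrow> 'b) \<Rightarrow> ('a \<Rightarrow> 'b) \<Rightarrow> bool" where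
  "rack_hom X t X' t' h \<longleftrightarrow> h \<in> X \<rightarrow> X' \<and> (\<forall>x\<in>X. \<forall>y\<in>X. h (t x y) = t' (h x) (h y))"

definition quasi_rack :: "'a set \<Rightarrow> ('a \<Rightarrow> 'a \<Rightarrow> 'a) \<Rightarrow> bool" where
  "quasi_rack X t \<longleftrightarrow> shelf X t \<and>
     (\<forall>x\<in>X. \<exists>g. relative_inverse X (t x) g) \<and>
     (\<forall>x\<in>X. \<forall>y\<in>X. \<forall>z\<in>X. rel_idem X (t x) (t y z) = t y (rel_idem X (t x) z))"

(* The index semilattice is the type 'i with meet inf; phi i j is only used for j <= i. *)
locale plonka_sum =
  fixes X :: "'a set" and t :: "'a \<Rightarrow> 'a \<Rightarrow> 'a"
    and A :: "'i::semilattice_inf \<Rightarrow> 'a set"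
    and s :: "'i \<Rightarrow> 'a \<Rightarrow> 'a \<Rightarrow> 'a"
    and \<phi> :: "'i \<Rightarrow> 'i \<Rightarrow> 'a \<Rightarrow> 'a"
  assumes disjoint: "disjoint_family A"
    and racks: "rack (A i) (s i)"
    and homs: "j \<le> i \<Longrightarrow> rack_hom (A i) (s i) (A j) (s j) (\<phi> i j)"
    and phi_id: "a \<in> A i \<Longrightarrow> \<phi> i i a = a"
    and phi_comp: "k \<le> j \<Longrightarrow> j \<le> i \<Longrightarrow> a \<in> A i \<Longrightarrow> \<phi> j k (\<phi> i j a) = \<phi> i k a"
    and carrier_eq: "X = (\<Union>i. A i)"
    and op_eq: "a \<in> A i \<Longrightarrow> b \<in> A j \<Longrightarrow>
                t a b = s (inf i j) (\<phi> i (inf i j) a) (\<phi> j (inf i j) b)"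

(* r12 r and r23 r are r x id and id x r on triples. *)

definition r12 :: "('a \<times> 'a \<Rightarrow> 'a \<times> 'a) \<Rightarrow> 'a \<times> 'a \<times> 'a \<Rightarrow> 'a \<times> 'a \<times> 'a" where
  "r12 r = (\<lambda>(x, y, z). case r (x, y) of (u, v) \<Rightarrow> (u, v, z))"

definition r23 :: "('a \<times> 'a \<Rightarrow> 'a \<times> 'a) \<Rightarrow> 'a \<times> 'a \<times> 'a \<Rightarrow> 'a \<times> 'a \<times> 'a" where
  "r23 r = (\<lambda>(x, y, z). (x, r (y, z)))"

definition solution :: "'a set \<Rightarrow> ('a \<times> 'a \<Rightarrow> 'a \<times> 'a) \<Rightarrow> bool" where
  "solution X r \<longleftrightarrow> r \<in> X \<times> X \<rightarrow> X \<times> X \<and>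
     (\<forall>p \<in> X \<times> X \<times> X. r12 r (r23 r (r12 r p)) = r23 r (r12 r (r23 r p)))"

definition lam :: "('a \<times> 'a \<Rightarrow> 'a \<times> 'a) \<Rightarrow> 'a \<Rightarrow> 'a \<Rightarrow> 'a" where
  "lam r x y = fst (r (x, y))"

definition rho :: "('a \<times> 'a \<Rightarrow> 'a \<times> 'a) \<Rightarrow> 'a \<Rightarrow> 'a \<Rightarrow> 'a" where
  "rho r y x = snd (r (x, y))"

definition quasi_bijective :: "'a set \<Rightarrow> ('a \<times> 'a \<Rightarrow> 'a \<times> 'a) \<Rightarrow> bool" where
  "quasi_bijective X r \<longleftrightarrow> (\<exists>r'. solution X r' \<and> relative_inverse (X \<times> X) r r')"

definition quasi_left_nondegenerate :: "'a set \<Rightarrow> ('a \<times> 'a \<Rightarrow> 'a \<times> 'a) \<Rightarrow> bool" where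
  "quasi_left_nondegenerate X r \<longleftrightarrow>
     (\<forall>x\<in>X. \<exists>g. relative_inverse X (lam r x) g) \<and>
     (\<forall>x\<in>X. \<forall>y\<in>X. \<forall>z\<in>X. rel_idem X (lam r x) (lam r y z) = lam r y (rel_idem X (lam r x) z))"

definition quasi_right_nondegenerate :: "'a set \<Rightarrow> ('a \<times> 'a \<Rightarrow> 'a \<times> 'a) \<Rightarrow> bool" where
  "quasi_right_nondegenerate X r \<longleftrightarrow>
     (\<forall>x\<in>X. \<exists>g. relative_inverse X (rho r x) g) \<and>
     (\<forall>x\<in>X. \<forall>y\<in>X. \<forall>z\<in>X. rel_idem X (rho r x) (rho r y z) = rho r y (rel_idem X (rho r x) z))"

definition quasi_nondegenerate :: "'a set \<Rightarrow> ('a \<times> 'a \<Rightarrow> 'a \<times> 'a) \<Rightarrow> bool" where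
  "quasi_nondegenerate X r \<longleftrightarrow> quasi_left_nondegenerate X r \<and> quasi_right_nondegenerate X r"

definition derived_map :: "'a set \<Rightarrow> ('a \<Rightarrow> 'a \<Rightarrow> 'a) \<Rightarrow> 'a \<times> 'a \<Rightarrow> 'a \<times> 'a" where
  "derived_map X t = (\<lambda>(x, y). (rel_idem X (t x) y, t y x))"

end

theory Submission imports Defs
begin

text \<open>
  The proof separates the sum from the Yang-Baxter equation.

  In a Plonka sum, translation by \<open>a \<in> A i\<close> first pushes \<open>b \<in> A j\<close> down to the component
  \<open>A (inf i j)\<close> and then acts there by a bijection. Pushing down and then inverting that
  bijection gives a relative inverse of \<open>L\<^sub>a\<close>, so the idempotent \<open>L\<^sub>a\<^sup>0\<close> is the push-down map \<open>\<phi> j (inf i j)\<close>. It depends on \<open>a\<close>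
  only through the index \<open>i\<close>. The quasi rack axiom holds because the push-downs are homomorphisms,
  \<open>L\<^sub>a\<^sup>0\<close> fixes \<open>a\<close> because \<open>inf i i = i\<close>, and \<open>L\<^sup>0\<close> is multiplicative because \<open>a \<triangleright> b\<close> has index \<open>inf i j\<close>
  (\<open>plonka_sum.multiplicative_quasi_rack\<close>).

  From there on only these identities matter; they are collected in the locale
  \<open>multiplicative_quasi_rack\<close>. They force the idempotents \<open>e\<^sub>c = L\<^sub>c\<^sup>0\<close> to commute with each other and to
  move freely through a product, \<open>(e\<^sub>c a) \<triangleright> b = e\<^sub>c (a \<triangleright> b) = a \<triangleright> (e\<^sub>c b)\<close>. Hence both sides of the
  braid equation reduce to the self-distributive law, up to idempotents that are absorbed.

  The axioms are moreover symmetric under exchanging \<open>L\<^sub>a\<close> with its relative inverse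
  (\<open>dual\<close>), just as the inverse operation of a rack is again a rack operation. The derived map of
  the dual, conjugated by the flip, is therefore a solution too, and it is the relative inverse of
  the derived map.
\<close>

section \<open>Relative inverses\<close>

lemma relative_inverse_sym:
  "relative_inverse Z f g \<Longrightarrow> relative_inverse Z g f"
  by (auto simp: relative_inverse_def)

lemma rel_idem_eq:
  assumes "relative_inverse Z f g" "z \<in> Z"
  shows "rel_idem Z f z = f (g z)"
  using relative_inverse_unique[OF rel_inv[of Z f]] assms
  unfolding rel_idem_def comp_def by metis

lemma relative_inverse_idempotent:
  assumes "f \<in> Z \<rightarrow> Z" "\<And>z. z \<in> Z \<Longrightarrow> f (f z) = f z"
  shows "relative_inverse Z f f"
  using assms by (auto simp: relative_inverse_def)

section \<open>Solutions and the flip\<close>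

text \<open>Reversing a triple exchanges the two factors acting in the braid equation, so the equation
  for the flipped map is the original one read from right to left.\<close>

lemma solution_flip:
  assumes "solution X r"
  shows "solution X (prod.swap \<circ> r \<circ> prod.swap)"
proof -
  define rev3 :: "'a \<times> 'a \<times> 'a \<Rightarrow> 'a \<times> 'a \<times> 'a" where "rev3 = (\<lambda>(x, y, z). (z, y, x))"
  let ?r = "prod.swap \<circ> r \<circ> prod.swap"
  have 12: "r12 ?r p = rev3 (r23 r (rev3 p))" and 23: "r23 ?r p = rev3 (r12 r (rev3 p))" for p
    by (auto simp: r12_def r23_def rev3_def split: prod.splits)
  have rev3_rev3: "rev3 (rev3 p) = p" for p
    by (auto simp: rev3_def split: prod.splits)
  have "r12 ?r (r23 ?r (r12 ?r p)) = r23 ?r (r12 ?r (r23 ?r p))" if "p \<in> X \<times> X \<times> X" for p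
  proof -
    have "rev3 p \<in> X \<times> X \<times> X"
      using that by (auto simp: rev3_def)
    then show ?thesis
      using assms unfolding solution_def 12 23 rev3_rev3 by metis
  qed
  moreover have "?r \<in> X \<times> X \<rightarrow> X \<times> X"
    using assms by (fastforce simp: solution_def Pi_iff)
  ultimately show ?thesis
    unfolding solution_def by blast
qed

section \<open>Quasi racks with multiplicative idempotents\<close>

text \<open>Here \<open>u x\<close> is a relative inverse of \<open>t x\<close> and \<open>e x\<close> the associated idempotent. They are
  parameters, determined only on \<open>X\<close>, rather than the values of \<^const>\<open>rel_inv\<close> and
  \<^const>\<open>rel_idem\<close>, so that exchanging \<open>t\<close> and \<open>u\<close> gives another instance with the same \<open>e\<close>.\<close>

locale multiplicative_quasi_rack =
  fixes X :: "'a set" and t u e :: "'a \<Rightarrow> 'a \<Rightarrow> 'a"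
  assumes shelf: "shelf X t"
    and inverse: "x \<in> X \<Longrightarrow> relative_inverse X (t x) (u x)"
    and e_eq: "x \<in> X \<Longrightarrow> y \<in> X \<Longrightarrow> e x y = t x (u x y)"
    and e_t: "x \<in> X \<Longrightarrow> y \<in> X \<Longrightarrow> z \<in> X \<Longrightarrow> e x (t y z) = t y (e x z)"
    and e_self: "x \<in> X \<Longrightarrow> e x x = x"
    and e_of_t: "x \<in> X \<Longrightarrow> y \<in> X \<Longrightarrow> z \<in> X \<Longrightarrow> e (t x y) z = e x (e y z)"
begin

lemma closed [simp]:
  assumes "x \<in> X" "y \<in> X"
  shows "t x y \<in> X" "u x y \<in> X" "e x y \<in> X"
  using assms inverse[of x] by (auto simp: e_eq relative_inverse_def)

lemma distrib: "x \<in> X \<Longrightarrow> y \<in> X \<Longrightarrow> z \<in> X \<Longrightarrow> t x (t y z) = t (t x y) (t x z)"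
  using shelf unfolding shelf_def by blast

lemma cancel [simp]:
  assumes "x \<in> X" "y \<in> X"
  shows "t x (u x y) = e x y" "u x (t x y) = e x y" "e x (t x y) = t x y" "t x (e x y) = t x y"
    "e x (u x y) = u x y" "u x (e x y) = u x y" "e x (e x y) = e x y"
  using assms inverse[of x] by (auto simp: e_eq relative_inverse_def)

text \<open>Both composites equal \<open>e\<^sub>y e\<^sub>x e\<^sub>y\<close>: as \<open>e\<^sub>x\<close> commutes with \<open>t\<^sub>y\<close>, the composite \<open>e\<^sub>x e\<^sub>y\<close> is
  \<open>t\<^sub>y e\<^sub>x u\<^sub>y\<close>, which absorbs \<open>e\<^sub>y\<close> on the left, and \<open>e\<^sub>y e\<^sub>x\<close> is \<open>u\<^sub>y e\<^sub>x t\<^sub>y\<close>, which absorbs it on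
  the right.\<close>

lemma e_commute:
  assumes "x \<in> X" "y \<in> X" "z \<in> X"
  shows "e x (e y z) = e y (e x z)"
proof -
  have "e x (e y z) = t y (e x (u y z))"
    using assms by (metis cancel(1) closed(2) e_t)
  then have "e x (e y z) = e y (e x (e y z))"
    using assms by (metis cancel(3) closed(2,3))
  moreover have "e y (e x z) = u y (e x (t y z))"
    using assms by (simp add: e_t)
  then have "e y (e x z) = e y (e x (e y z))"
    using assms by (metis cancel(2,4) closed(3) e_t)
  ultimately show ?thesis by simp
qed

lemma e_absorb: "x \<in> X \<Longrightarrow> y \<in> X \<Longrightarrow> e x (e y x) = e y x"
  by (simp add: e_commute[of x y] e_self)

lemma e_u:
  assumes "x \<in> X" "y \<in> X" "z \<in> X"
  shows "e x (u y z) = u y (e x z)"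
proof -
  have "u y (e x z) = u y (e x (e y z))"
    using assms by (metis cancel(6) closed(3) e_commute)
  also have "e x (e y z) = t y (e x (u y z))"
    using assms by (metis cancel(1) closed(2) e_t)
  also have "u y \<dots> = e x (e y (u y z))"
    using assms by (simp add: e_commute)
  finally show ?thesis using assms by simp
qed

lemma t_inj_on_fixed:
  assumes "x \<in> X" "y \<in> X" "z \<in> X" "e x y = y" "e x z = z" "t x y = t x z"
  shows "y = z"
  using assms by (metis cancel(2))

text \<open>Since \<open>t\<^sub>c (e\<^sub>c a) = t\<^sub>c a\<close>, applying \<open>e\<^bsub>t\<^sub>c w\<^esub> = e\<^sub>c e\<^sub>w\<close> to \<open>w = e\<^sub>c a\<close> and to \<open>w = a\<close> yields
  \<open>e\<^sub>c e\<^bsub>e\<^sub>c a\<^esub> = e\<^sub>c e\<^sub>a\<close>. The outer \<open>e\<^sub>c\<close> on the left is absorbed as \<open>e\<^sub>c a = t\<^sub>c (u\<^sub>c a)\<close>.\<close>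

lemma e_of_e:
  assumes "c \<in> X" "a \<in> X" "z \<in> X"
  shows "e (e c a) z = e c (e a z)"
proof -
  have "e (e c a) z = e c (e (u c a) z)"
    using assms by (metis cancel(1) closed(2) e_of_t)
  then have "e (e c a) z = e c (e (e c a) z)"
    using assms by simp
  also have "\<dots> = e (t c (e c a)) z"
    using assms by (simp only: e_of_t closed)
  finally show ?thesis
    using assms by (simp add: e_of_t)
qed

lemma e_of_u:
  assumes "c \<in> X" "a \<in> X" "z \<in> X"
  shows "e (u c a) z = e c (e a z)"
proof -
  have "e (u c a) z = e c (e (u c a) z)"
    using e_of_e[of c "u c a" z] assms by simp
  also have "\<dots> = e (e c a) z"
    using e_of_t[of c "u c a" z] assms by simp
  finally show ?thesis using assms by (simp add: e_of_e)
qed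

text \<open>On the image of \<open>e\<^sub>c\<close> the map \<open>t\<^sub>c\<close> is injective, and self-distributivity gives both
  \<open>t\<^sub>c ((e\<^sub>c a) \<triangleright> (e\<^sub>c b))\<close> and \<open>t\<^sub>c (a \<triangleright> (e\<^sub>c b))\<close> the value \<open>(t\<^sub>c a) \<triangleright> (t\<^sub>c b)\<close>. An arbitrary
  right factor reduces to this case: translation by \<open>e\<^sub>c a\<close> absorbs \<open>e\<^bsub>e\<^sub>c a\<^esub> = e\<^sub>c e\<^sub>a\<close>.\<close>

lemma t_e_left:
  assumes "c \<in> X" "a \<in> X" "b \<in> X"
  shows "t (e c a) b = e c (t a b)"
proof -
  have *: "t (e c a) (e c z) = t a (e c z)" if "z \<in> X" for z
  proof (rule t_inj_on_fixed[of c])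
    show "t c (t (e c a) (e c z)) = t c (t a (e c z))"
      using assms that by (simp add: distrib[of c "e c a"] distrib[of c a])
  qed (use assms that in \<open>simp_all add: e_t\<close>)
  have "t (e c a) b = t (e c a) (e (e c a) b)"
    using assms by simp
  also have "\<dots> = t a (e c (e a b))"
    using assms by (simp only: e_of_e closed *)
  also have "\<dots> = e c (t a b)"
    using assms by (simp add: e_t[symmetric])
  finally show ?thesis .
qed

text \<open>Translation by \<open>u\<^sub>a b\<close> is the conjugate \<open>u\<^sub>a t\<^sub>b t\<^sub>a\<close>, as in a rack.\<close>

lemma t_of_u:
  assumes "a \<in> X" "b \<in> X" "z \<in> X"
  shows "t (u a b) z = u a (t b (t a z))"
proof -
  have "t a (t (u a b) z) = t b (t a z)"
    using assms by (simp add: distrib[of a "u a b"] t_e_left e_t)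
  moreover have "e a (t (u a b) z) = t (u a b) z"
    using t_e_left[of a "u a b" z] assms by simp
  ultimately show ?thesis
    using assms by (metis cancel(2) closed(1,2))
qed

text \<open>As translation by \<open>u\<^sub>a b\<close> is a conjugate, it sends both sides of the self-distributive law for
  \<open>u\<close> to \<open>e\<^sub>b (u\<^sub>a c)\<close>; both sides lie where that translation is injective.\<close>

lemma shelf_inverse: "shelf X u"
  unfolding shelf_def
proof (intro conjI ballI)
  fix a b c assume X: "a \<in> X" "b \<in> X" "c \<in> X"
  show "u a (u b c) = u (u a b) (u a c)"
  proof (rule t_inj_on_fixed[of "u a b"])
    have "t (u a b) (u a (u b c)) = u a (t b (e a (u b c)))"
      using X by (simp add: t_of_u)
    also have "\<dots> = u a (e a (e b c))"
      using X by (simp add: e_t[symmetric])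
    also have "\<dots> = e b (u a c)"
      using X by (simp add: e_u)
    also have "\<dots> = e (u a b) (u a c)"
      using X by (simp add: e_of_u e_u)
    also have "\<dots> = t (u a b) (u (u a b) (u a c))"
      using X by simp
    finally show "t (u a b) (u a (u b c)) = t (u a b) (u (u a b) (u a c))" .
    show "e (u a b) (u a (u b c)) = u a (u b c)"
      using X by (simp add: e_of_u e_u[of b a "u b c"])
  qed (use X in simp_all)
qed simp

sublocale dual: multiplicative_quasi_rack X u t e
proof
  show "shelf X u" by (rule shelf_inverse)
  show "relative_inverse X (u x) (t x)" if "x \<in> X" for x
    using inverse[OF that] by (rule relative_inverse_sym)
qed (simp_all add: e_u e_self e_of_u)

text \<open>The middle components of the two sides both reduce to \<open>e\<^sub>x (z \<triangleright> y)\<close>; the last ones agree by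
  self-distributivity, as \<open>y \<triangleright> x\<close> absorbs the stray \<open>e\<^sub>y\<close>.\<close>

lemma derived_solution: "solution X (\<lambda>(x, y). (e x y, t y x))"
proof -
  let ?r = "\<lambda>(x, y). (e x y, t y x)"
  have "r12 ?r (r23 ?r (r12 ?r (x, y, z))) = r23 ?r (r12 ?r (r23 ?r (x, y, z)))"
    if X: "x \<in> X" "y \<in> X" "z \<in> X" for x y z
  proof -
    have "e (e x y) (e (t y x) z) = e x (e y z)"
      using X by (simp add: e_of_e e_of_t e_commute)
    moreover have "t (e (t y x) z) (e x y) = e (t (e y z) x) (t z y)"
    proof -
      have "t (e (t y x) z) (e x y) = e x (e y (t z y))"
        using X by (simp add: e_of_t t_e_left e_t[symmetric] e_commute)
      moreover have "e (t (e y z) x) (t z y) = e x (e y (t z y))"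
        using X by (simp add: e_of_t e_of_e e_commute)
      ultimately show ?thesis by simp
    qed
    moreover have "t z (t y x) = t (t z y) (t (e y z) x)"
    proof -
      have "t (t z y) (t (e y z) x) = e y (t (t z y) (t z x))"
        using X by (simp add: t_e_left e_t)
      also have "\<dots> = t z (e y (t y x))"
        using X by (simp only: distrib[symmetric] e_t closed)
      finally show ?thesis using X by simp
    qed
    ultimately show ?thesis by (simp add: r12_def r23_def)
  qed
  then show ?thesis by (auto simp: solution_def)
qed

end

context multiplicative_quasi_rack
begin

text \<open>The relative inverse is \<open>(x, y) \<mapsto> (u\<^sub>x y, e\<^sub>y x)\<close>, the flipped derived map of the dual; the
  associated idempotent is \<open>(x, y) \<mapsto> (e\<^sub>y x, e\<^sub>x y)\<close>.\<close>

lemma derived_quasi_bijective: "quasi_bijective X (\<lambda>(x, y). (e x y, t y x))"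
proof -
  let ?r = "\<lambda>(x, y). (e x y, t y x)"
  let ?r' = "prod.swap \<circ> (\<lambda>(x, y). (e x y, u y x)) \<circ> prod.swap"
  have r'r: "?r' (?r (x, y)) = (e y x, e x y)" and rr': "?r (?r' (x, y)) = (e y x, e x y)"
    if "x \<in> X" "y \<in> X" for x y
    using that
    by (simp_all add: e_of_t e_of_u e_of_e t_e_left dual.t_e_left e_absorb e_self e_t[symmetric])
  have "relative_inverse (X \<times> X) ?r ?r'"
    unfolding relative_inverse_def
  proof (intro conjI ballI)
    fix p assume "p \<in> X \<times> X"
    then obtain x y where p: "p = (x, y)" "x \<in> X" "y \<in> X" by auto
    show "?r (?r' p) = ?r' (?r p)"
      using p r'r[of x y] rr'[of x y] by simp
    have "?r (?r' (?r p)) = ?r (e y x, e x y)"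
      using p r'r[of x y] by simp
    also have "\<dots> = ?r p"
      using p by (simp add: e_of_e t_e_left e_absorb e_self e_t)
    finally show "?r (?r' (?r p)) = ?r p" .
    have "?r' (?r (?r' p)) = ?r' (e y x, e x y)"
      using p rr'[of x y] by simp
    also have "\<dots> = ?r' p"
      using p by (simp add: e_of_e dual.t_e_left e_absorb e_self e_u)
    finally show "?r' (?r (?r' p)) = ?r' p" .
  qed auto
  then show ?thesis
    using solution_flip[OF dual.derived_solution] by (auto simp: quasi_bijective_def)
qed

lemma rel_idem_translation:
  "x \<in> X \<Longrightarrow> z \<in> X \<Longrightarrow> rel_idem X (t x) z = e x z"
  by (simp add: rel_idem_eq[OF inverse])

lemma derived_quasi_nondegenerate: "quasi_nondegenerate X (\<lambda>(x, y). (e x y, t y x))"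
proof -
  let ?r = "\<lambda>(x, y). (e x y, t y x)"
  have lam: "lam ?r x = e x" and rho: "rho ?r x = t x" for x
    by (auto simp: lam_def rho_def)
  have inv: "relative_inverse X (e x) (e x)" if "x \<in> X" for x
    using that by (intro relative_inverse_idempotent) auto
  then have idem: "rel_idem X (e x) z = e x z" if "x \<in> X" "z \<in> X" for x z
    using rel_idem_eq that by fastforce
  have "quasi_left_nondegenerate X ?r"
    unfolding quasi_left_nondegenerate_def lam
    using inv by (auto simp: idem e_commute)
  moreover have "quasi_right_nondegenerate X ?r"
    unfolding quasi_right_nondegenerate_def rho
    using inverse by (auto simp: rel_idem_translation e_t)
  ultimately show ?thesis by (simp add: quasi_nondegenerate_def)
qed

lemma quasi_rack: "quasi_rack X t"
  using shelf inverse by (auto simp: quasi_rack_def rel_idem_translation e_t)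

text \<open>Relative inverses are unique on \<open>X\<close>, so \<open>u\<close> and \<open>e\<close> agree there with the canonical choice, for
  which \<open>(x, y) \<mapsto> (e\<^sub>x y, y \<triangleright> x)\<close> is literally the derived map.\<close>

lemma canonical: "multiplicative_quasi_rack X t (\<lambda>x. rel_inv X (t x)) (\<lambda>x. rel_idem X (t x))"
proof
  show "relative_inverse X (t x) (rel_inv X (t x))" if "x \<in> X" for x
    using inverse[OF that] rel_inv by blast
  show "rel_idem X (t x) y = t x (rel_inv X (t x) y)" if "x \<in> X" "y \<in> X" for x y
    by (simp add: rel_idem_def)
qed (simp_all add: shelf rel_idem_translation e_t e_self e_of_t)

end

section \<open>Plonka sums\<close>

context plonka_sum
begin

definition index :: "'a \<Rightarrow> 'i" where
  "index a = (THE i. a \<in> A i)"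

lemma index_eq: "a \<in> A i \<Longrightarrow> index a = i"
  unfolding index_def using disjoint
  by (auto simp: disjoint_family_on_def intro!: the_equality)

lemma phi_closed: "j \<le> i \<Longrightarrow> a \<in> A i \<Longrightarrow> \<phi> i j a \<in> A j"
  using homs by (auto simp: rack_hom_def)

lemma phi_hom: "j \<le> i \<Longrightarrow> a \<in> A i \<Longrightarrow> b \<in> A i \<Longrightarrow> \<phi> i j (s i a b) = s j (\<phi> i j a) (\<phi> i j b)"
  using homs by (auto simp: rack_hom_def)

lemma bij_s: "a \<in> A i \<Longrightarrow> bij_betw (s i a) (A i) (A i)"
  using racks by (auto simp: rack_def)

lemma s_closed: "a \<in> A i \<Longrightarrow> b \<in> A i \<Longrightarrow> s i a b \<in> A i"
  using racks by (auto simp: rack_def shelf_def)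

lemma s_distrib:
  "a \<in> A i \<Longrightarrow> b \<in> A i \<Longrightarrow> c \<in> A i \<Longrightarrow> s i a (s i b c) = s i (s i a b) (s i a c)"
  using racks unfolding rack_def shelf_def by blast

text \<open>\<open>push a\<close> is the idempotent \<open>L\<^sub>a\<^sup>0\<close> of the translation by \<open>a\<close>, and \<open>undo a\<close> the relative
  inverse of that translation: it pushes down as the translation does, and then inverts
  the rack translation there.\<close>

definition push :: "'a \<Rightarrow> 'a \<Rightarrow> 'a" where
  "push a b = \<phi> (index b) (inf (index a) (index b)) b"

definition undo :: "'a \<Rightarrow> 'a \<Rightarrow> 'a" where
  "undo a b = (let k = inf (index a) (index b) in inv_into (A k) (s k (push b a)) (push a b))"

lemma push_eq: "a \<in> A i \<Longrightarrow> b \<in> A j \<Longrightarrow> push a b = \<phi> j (inf i j) b"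
  by (simp add: push_def index_eq)

lemma push_closed: "a \<in> A i \<Longrightarrow> b \<in> A j \<Longrightarrow> push a b \<in> A (inf i j)"
  by (simp add: push_eq phi_closed)

lemma t_eq:
  assumes "a \<in> A i" "b \<in> A j"
  shows "t a b = s (inf i j) (push b a) (push a b)"
  using assms op_eq[OF assms] by (simp add: push_eq inf_commute)

lemma t_closed:
  assumes "a \<in> A i" "b \<in> A j"
  shows "t a b \<in> A (inf i j)"
  using assms s_closed push_closed by (metis inf_commute t_eq)

text \<open>A product may be pushed down factor by factor, which brings nested products into one common
  component, where the rack laws apply.\<close>

lemma phi_t:
  assumes "a \<in> A i" "b \<in> A j" "k \<le> inf i j"
  shows "\<phi> (inf i j) k (t a b) = s k (\<phi> i k a) (\<phi> j k b)"
  using assms by (simp add: op_eq phi_hom phi_closed phi_comp)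

lemma undo_closed:
  assumes "a \<in> A i" "b \<in> A j"
  shows "undo a b \<in> A (inf i j)"
  using inv_into_into[of "push a b" "s (inf i j) (push b a)" "A (inf i j)"]
    bij_betw_imp_surj_on[OF bij_s[of "push b a" "inf i j"]]
    push_closed[OF assms] push_closed[OF assms(2,1)] assms
  by (simp add: undo_def index_eq Let_def inf_commute)

lemma t_undo:
  assumes "a \<in> A i" "b \<in> A j"
  shows "t a (undo a b) = push a b"
proof -
  let ?k = "inf i j"
  have a: "push b a \<in> A ?k" and b: "push a b \<in> A ?k"
    using assms push_closed by (metis inf_commute)+
  have "t a (undo a b) = s ?k (push b a) (undo a b)"
    using assms undo_closed[OF assms] by (simp add: op_eq push_eq phi_id inf_commute)
  also have "\<dots> = push a b"
    using bij_betw_inv_into_right[OF bij_s[OF a] b] assms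
    by (simp add: undo_def index_eq Let_def)
  finally show ?thesis .
qed

lemma undo_t:
  assumes "a \<in> A i" "b \<in> A j"
  shows "undo a (t a b) = push a b"
proof -
  let ?k = "inf i j"
  have a: "push b a \<in> A ?k" and b: "push a b \<in> A ?k"
    using assms push_closed by (metis inf_commute)+
  have t: "t a b \<in> A ?k" using assms by (rule t_closed)
  have "undo a (t a b) = inv_into (A ?k) (s ?k (push b a)) (t a b)"
    using assms t by (simp add: undo_def index_eq push_eq phi_id Let_def inf_commute)
  also have "\<dots> = push a b"
    using bij_betw_inv_into_left[OF bij_s[OF a] b] assms by (simp add: t_eq)
  finally show ?thesis .
qed

lemma push_fixed:
  assumes "a \<in> A i" "b \<in> A j" "j \<le> i"
  shows "push a b = b"
  using assms by (simp add: push_eq inf_absorb2 phi_id)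

lemma undo_push:
  assumes "a \<in> A i" "b \<in> A j"
  shows "undo a (push a b) = undo a b"
  using assms push_closed[OF assms] push_fixed[OF assms(1) push_closed[OF assms]]
  by (simp add: undo_def index_eq push_eq inf_commute)

lemma in_component: "a \<in> X \<Longrightarrow> (\<And>i. a \<in> A i \<Longrightarrow> P) \<Longrightarrow> P"
  using carrier_eq by auto

lemma component_subset: "a \<in> A i \<Longrightarrow> a \<in> X"
  using carrier_eq by auto

lemma relative_inverse_undo:
  assumes "a \<in> X"
  shows "relative_inverse X (t a) (undo a)"
proof -
  obtain i where a: "a \<in> A i" using assms by (rule in_component)
  have "t a b \<in> X \<and> undo a b \<in> X \<and> t a (undo a (t a b)) = t a b
      \<and> undo a (t a (undo a b)) = undo a b \<and> t a (undo a b) = undo a (t a b)" if "b \<in> X" for b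
  proof -
    obtain j where b: "b \<in> A j" using \<open>b \<in> X\<close> by (rule in_component)
    have "push a (t a b) = t a b"
      using a t_closed[OF a b] by (rule push_fixed) simp
    then have "t a (undo a (t a b)) = t a b"
      using t_undo[OF a t_closed[OF a b]] by simp
    then show ?thesis
      using component_subset t_closed[OF a b] undo_closed[OF a b]
      by (simp add: t_undo[OF a b] undo_t[OF a b] undo_push[OF a b])
  qed
  then show ?thesis unfolding relative_inverse_def Pi_iff by blast
qed

lemma shelf_sum: "shelf X t"
  unfolding shelf_def
proof (intro conjI ballI)
  fix a b assume X: "a \<in> X" "b \<in> X"
  show "t a b \<in> X"
    using relative_inverse_undo[OF X(1)] X(2) by (auto simp only: relative_inverse_def Pi_iff)
next
  fix a b c assume "a \<in> X" "b \<in> X" "c \<in> X"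
  then obtain i j k where X: "a \<in> A i" "b \<in> A j" "c \<in> A k"
    using carrier_eq by blast
  let ?m = "inf i (inf j k)"
  note cl = t_closed[OF X(1,2)] t_closed[OF X(1,3)] t_closed[OF X(2,3)]
  have m: "inf (inf i j) (inf i k) = ?m" by (simp add: inf_aci)
  have le: "?m \<le> inf i j" "?m \<le> inf i k" "?m \<le> inf j k" "?m \<le> i" "?m \<le> j" "?m \<le> k"
    by (auto intro: le_infI1 le_infI2)
  note p = phi_closed[OF le(4) X(1)] phi_closed[OF le(5) X(2)] phi_closed[OF le(6) X(3)]
  have "t a (t b c) = s ?m (\<phi> i ?m a) (s ?m (\<phi> j ?m b) (\<phi> k ?m c))"
    by (simp only: op_eq[OF X(1) cl(3)] phi_t[OF X(2,3) le(3)])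
  moreover have "t (t a b) (t a c)
      = s ?m (s ?m (\<phi> i ?m a) (\<phi> j ?m b)) (s ?m (\<phi> i ?m a) (\<phi> k ?m c))"
    by (simp only: op_eq[OF cl(1,2)] m phi_t[OF X(1,2) le(1)] phi_t[OF X(1,3) le(2)])
  ultimately show "t a (t b c) = t (t a b) (t a c)"
    using s_distrib[OF p] by simp
qed

lemma push_t:
  assumes "a \<in> X" "b \<in> X" "c \<in> X"
  shows "push a (t b c) = t b (push a c)"
proof -
  obtain i j k where X: "a \<in> A i" "b \<in> A j" "c \<in> A k"
    using assms carrier_eq by blast
  let ?m = "inf i (inf j k)"
  have m: "inf j (inf i k) = ?m" by (simp add: inf_aci)
  have le: "?m \<le> inf j k" "?m \<le> inf i k" by (auto intro: le_infI1 le_infI2)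
  have "push a (t b c) = s ?m (\<phi> j ?m b) (\<phi> k ?m c)"
    using push_eq[OF X(1) t_closed[OF X(2,3)]] phi_t[OF X(2,3) le(1)] by simp
  also have "\<dots> = t b (push a c)"
    using op_eq[OF X(2) push_closed[OF X(1,3)]] le(2)
    by (simp add: m push_eq[OF X(1,3)] phi_comp[OF _ _ X(3)])
  finally show ?thesis .
qed

lemma push_of_t:
  assumes "a \<in> X" "b \<in> X" "c \<in> X"
  shows "push (t a b) c = push a (push b c)"
proof -
  obtain i j k where X: "a \<in> A i" "b \<in> A j" "c \<in> A k"
    using assms carrier_eq by blast
  show ?thesis
    using push_eq[OF t_closed[OF X(1,2)] X(3)] push_eq[OF X(1) push_closed[OF X(2,3)]]
    by (simp add: push_eq[OF X(2,3)] phi_comp[OF _ _ X(3)] inf_assoc le_infI2)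
qed

lemma push_self: "a \<in> X \<Longrightarrow> push a a = a"
  by (meson in_component order_refl push_fixed)

lemma multiplicative_quasi_rack: "multiplicative_quasi_rack X t undo push"
proof
  show "push a b = t a (undo a b)" if "a \<in> X" "b \<in> X" for a b
    using that by (metis in_component t_undo)
qed (simp_all add: shelf_sum relative_inverse_undo push_t push_of_t push_self)

end

theorem theorem5p2:
  fixes X :: "'a set" and t :: "'a \<Rightarrow> 'a \<Rightarrow> 'a"
    and A :: "'i::semilattice_inf \<Rightarrow> 'a set"
    and s :: "'i \<Rightarrow> 'a \<Rightarrow> 'a \<Rightarrow> 'a"
    and \<phi> :: "'i \<Rightarrow> 'i \<Rightarrow> 'a \<Rightarrow> 'a"
  assumes "plonka_sum X t A s \<phi>"
  shows "quasi_rack X t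
    \<and> (\<forall>a\<in>X. rel_idem X (t a) a = a)
    \<and> (\<forall>a\<in>X. \<forall>b\<in>X. \<forall>z\<in>X. rel_idem X (t (t a b)) z = rel_idem X (t a) (rel_idem X (t b) z))
    \<and> solution X (derived_map X t)
    \<and> quasi_bijective X (derived_map X t)
    \<and> quasi_nondegenerate X (derived_map X t)"
proof -
  interpret multiplicative_quasi_rack X t "\<lambda>x. rel_inv X (t x)" "\<lambda>x. rel_idem X (t x)"
    by (rule multiplicative_quasi_rack.canonical[OF plonka_sum.multiplicative_quasi_rack[OF assms]])
  show ?thesis
    using quasi_rack e_self e_of_t derived_solution derived_quasi_bijective
      derived_quasi_nondegenerate
    by (simp add: derived_map_def)
qed

end
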